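(* Let $n\ge1$, $a<b$, and let $\gamma:[a,b]\to\mathbb{R}^n$, $\gamma\in C([a,b])\cap C^n((a,b))$, be a curve with totally positive torsion. Then its Carathéodory number equals $\lfloor\frac{n+2}{2}\rfloor$.
   Context: A curve $\gamma\in C([a,b],\mathbb{R}^{n})\cap C^{n}((a,b),\mathbb{R}^{n})$ has totally positive torsion if for every $t\in(a,b)$ all leading principal minors of the $n\times n$ matrix with columns $(\gamma'(t),\gamma''(t),\dots,\gamma^{(n)}(t))$ are positive. The Carathéodory number of $\gamma$ is the smallest integer $k$ such that every point of the convex hull $\mathrm{conv}(\gamma([a,b]))$ can be represented as a convex combination of at most $k$ points of $\gamma([a,b])$. *)

theory Defs
  imports "HOL-Analysis.Analysis" "Jordan_Normal_Form.Determinant"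
begin

no_notation Matrix.vec_index (infixl "$" 100)

definition nth_vector_derivative ::
    "nat \<Rightarrow> (real \<Rightarrow> 'a::real_normed_vector) \<Rightarrow> real \<Rightarrow> 'a" where
  "nth_vector_derivative k f = ((\<lambda>g t. vector_derivative g (at t)) ^^ k) f"

text \<open>
  The derivatives are two-sided, so this is the class of \<open>k\<close> times continuously differentiable
  curves only for open \<open>S\<close>; there it does not depend on the values of \<open>f\<close> outside \<open>S\<close>.
\<close>
definition Ck_on :: "nat \<Rightarrow> real set \<Rightarrow> (real \<Rightarrow> 'a::real_normed_vector) \<Rightarrow> bool" where
  "Ck_on k S f \<longleftrightarrow>
     (\<forall>j<k. \<forall>t\<in>S. nth_vector_derivative j f differentiable (at t)) \<and>
     (\<forall>j\<le>k. continuous_on S (nth_vector_derivative j f))"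

text \<open>
  Leading minors need ordered coordinates. The coordinates of \<open>real ^ 'n\<close> are numbered
  \<open>0, \<dots>, CARD('n) - 1\<close> along the linear order of the index type.
\<close>
definition coord :: "nat \<Rightarrow> 'n::{finite,linorder}" where
  "coord i = sorted_list_of_set (UNIV :: 'n set) ! i"

text \<open>Matrices are indexed from 0, so column \<open>j\<close> holds the derivative of order \<open>j + 1\<close>.\<close>
definition torsion_matrix ::
    "(real \<Rightarrow> real ^ 'n::{finite,linorder}) \<Rightarrow> real \<Rightarrow> real Matrix.mat" where
  "torsion_matrix \<gamma> t =
     Matrix.mat CARD('n) CARD('n) (\<lambda>(i, j). nth_vector_derivative (Suc j) \<gamma> t $ coord i)"

definition leading_principal_minor :: "'a::comm_ring_1 Matrix.mat \<Rightarrow> nat \<Rightarrow> 'a" where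
  "leading_principal_minor A k = Determinant.det (Matrix.mat k k (\<lambda>(i, j). A $$ (i, j)))"

definition totally_positive_torsion ::
    "real \<Rightarrow> real \<Rightarrow> (real \<Rightarrow> real ^ 'n::{finite,linorder}) \<Rightarrow> bool" where
  "totally_positive_torsion a b \<gamma> \<longleftrightarrow>
     continuous_on {a..b} \<gamma> \<and> Ck_on CARD('n) {a<..<b} \<gamma> \<and>
     (\<forall>t\<in>{a<..<b}. \<forall>k\<in>{1..CARD('n)}. leading_principal_minor (torsion_matrix \<gamma> t) k > 0)"

definition convex_combination_of_at_most ::
    "nat \<Rightarrow> 'a::real_vector set \<Rightarrow> 'a \<Rightarrow> bool" where
  "convex_combination_of_at_most k X x \<longleftrightarrow>
     (\<exists>S u. finite S \<and> S \<subseteq> X \<and> card S \<le> k \<and>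
        (\<forall>p\<in>S. 0 \<le> u p) \<and> sum u S = 1 \<and> (\<Sum>p\<in>S. u p *\<^sub>R p) = x)"

text \<open>
  By Caratheodory's theorem some \<open>k\<close> with this property exists whenever \<open>'a\<close> is a Euclidean space,
  so the least one is meaningful.
\<close>
definition caratheodory_number :: "'a::real_vector set \<Rightarrow> nat" where
  "caratheodory_number X = (LEAST k. \<forall>x\<in>convex hull X. convex_combination_of_at_most k X x)"

end

theory Submission
  imports Defs
begin

text \<open>
  Write \<open>n\<close> for the dimension. The torsion enters through one fact: for \<open>c \<noteq> 0\<close> the function
  \<open>t \<mapsto> c \<bullet> \<gamma>' t\<close> has fewer than \<open>n\<close> zeros in the open interval
  (\<open>card_zeros_inner_derivative_less\<close>). Two consequences follow by Rolle's theorem. A hyperplane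
  meets the curve at no more than \<open>n\<close> parameters. A hyperplane that supports an arc
  \<open>\<gamma> ` {a..s}\<close> touches it at \<open>m\<close> parameters with \<open>2 * m \<le> n + 2\<close>: the derivative vanishes between
  neighbouring contacts and again at each contact that is not an end of the arc, so at least
  \<open>(m - 1) + (m - 2)\<close> times.

  Upper bound. Given \<open>x\<close> in the convex hull, let \<open>s\<close> be the least parameter such that \<open>x\<close> is in
  the convex hull of \<open>\<gamma> ` {a..s}\<close>. A finite convex combination of points of \<open>\<gamma> ` {a..<s}\<close> only
  involves parameters up to some \<open>r < s\<close>, so \<open>x\<close> is not in the convex hull of that half-open arc.
  Hence a hyperplane separates the two, and by continuity the hyperplane through \<open>x\<close> parallel to it
  has all of \<open>\<gamma> ` {a..s}\<close> on one side. A convex combination of points of this arc that equals \<open>x\<close>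
  can give positive weight only to points of contact, and there are at most \<open>(n + 2) div 2\<close> of
  these.

  Lower bound. Since hyperplanes meet the curve at no more than \<open>n\<close> parameters, any \<open>n + 1\<close> of its
  points are affinely independent. The barycentre of \<open>k = (n + 2) div 2\<close> points of the curve is then
  not a convex combination of fewer: two such representations would involve at most
  \<open>2 * k - 1 \<le> n + 1\<close> points together, and their difference would be an affine dependence.

  The bound on zeros goes by induction on the number of functions: divide by the first function,
  which the first minor makes positive, and differentiate. On the matrix of derivatives this is one
  step of Gaussian elimination, which keeps the leading minors positive.
\<close>

no_notation Matrix.scalar_prod (infix \<open>\<bullet>\<close> 70)

section \<open>Counting zeros with Rolle's theorem\<close>

text \<open>
  The zeros of the derivative that Rolle's theorem supplies lie strictly between consecutive
  elements of \<open>Z\<close>. That they avoid \<open>Z\<close> allows them to be counted together with stationary points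
  that belong to \<open>Z\<close>.
\<close>
lemma Rolle_zeros_between:
  fixes f f' :: "real \<Rightarrow> real"
  assumes "finite Z" "Z \<noteq> {}" "Z \<subseteq> S" "is_interval S" "continuous_on S f"
    and der: "\<And>t. t \<in> interior S \<Longrightarrow> (f has_real_derivative f' t) (at t)"
    and "\<And>t. t \<in> Z \<Longrightarrow> f t = 0"
  obtains W where "finite W" "W \<subseteq> interior S" "W \<inter> Z = {}" "Suc (card W) = card Z"
    "\<And>t. t \<in> W \<Longrightarrow> f' t = 0"
proof -
  \<comment> \<open>The bound \<open>w < z\<close> keeps the zeros found so far apart from the one to the right of the
    previous maximum.\<close>
  have "Z \<noteq> {} \<longrightarrow> Z \<subseteq> S \<longrightarrow> (\<forall>t\<in>Z. f t = 0) \<longrightarrow>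
    (\<exists>W. finite W \<and> W \<subseteq> interior S \<and> W \<inter> Z = {} \<and> Suc (card W) = card Z \<and>
      (\<forall>t\<in>W. f' t = 0) \<and> (\<forall>w\<in>W. \<exists>z\<in>Z. w < z))"
    using assms(1)
  proof (induction Z rule: finite_linorder_max_induct)
    case empty
    then show ?case by simp
  next
    case (insert z A)
    show ?case
    proof (intro impI)
      assume sub: "insert z A \<subseteq> S" and zero: "\<forall>t\<in>insert z A. f t = 0"
      show "\<exists>W. finite W \<and> W \<subseteq> interior S \<and> W \<inter> insert z A = {} \<and>
        Suc (card W) = card (insert z A) \<and> (\<forall>t\<in>W. f' t = 0) \<and>
        (\<forall>w\<in>W. \<exists>z\<in>insert z A. w < z)"
      proof (cases "A = {}")
        case True
        then show ?thesis by (intro exI[of _ "{}"]) simp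
      next
        case False
        then obtain W where W: "finite W" "W \<subseteq> interior S" "W \<inter> A = {}" "Suc (card W) = card A"
          "\<forall>t\<in>W. f' t = 0" "\<forall>w\<in>W. \<exists>z\<in>A. w < z"
          using insert sub zero by auto
        define m where "m = Max A"
        have m: "m \<in> A" "\<And>y. y \<in> A \<Longrightarrow> y \<le> m"
          using insert(1) False by (auto simp: m_def)
        have mz: "m < z" using insert(2) m by auto
        have seg: "{m..z} \<subseteq> S"
          using mem_is_interval_1_I[OF assms(4), of m z] sub m by auto
        then have seg': "{m<..<z} \<subseteq> interior S"
          by (intro interior_maximal) auto
        obtain w where w: "m < w" "w < z" "DERIV f w :> 0"
        proof -
          have "\<exists>w. m < w \<and> w < z \<and> DERIV f w :> 0"
          proof (rule Rolle[OF mz])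
            show "f m = f z" using zero m by simp
            show "continuous_on {m..z} f" using assms(5) seg by (rule continuous_on_subset)
            show "f differentiable (at t)" if "m < t" "t < z" for t
            proof -
              have "t \<in> interior S" using seg' that by auto
              then show ?thesis using der real_differentiable_def by blast
            qed
          qed
          then show ?thesis using that by blast
        qed
        have wS: "w \<in> interior S" using w seg' by auto
        have "f' w = 0" using DERIV_unique[OF der[OF wS] w(3)] .
        have "w \<notin> W" using W(6) m w(1) by force
        moreover have "z \<notin> W" using W(6) insert(2) by force
        moreover have "w \<notin> A" using m w(1) by force
        moreover have "z \<notin> A" using insert(2) by auto
        ultimately show ?thesis
          using W w wS \<open>f' w = 0\<close> insert(1)
          by (intro exI[of _ "insert w W"]) auto
      qed
    qed
  qed
  then show ?thesis using assms that by blast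
qed

section \<open>Zeros of linear combinations and leading minors\<close>

text \<open>
  Gaussian elimination of the first column factors the matrix as \<open>P * Q\<close>, with \<open>P\<close> lower triangular
  with unit diagonal and \<open>Q\<close> having only the pivot in its first column.
\<close>
lemma det_eq_pivot_times_det_Schur_complement:
  fixes G :: "nat \<Rightarrow> nat \<Rightarrow> 'a::field"
  assumes "G 0 0 \<noteq> 0"
  shows "Determinant.det (Matrix.mat (Suc k) (Suc k) (\<lambda>(i, j). G i j)) =
    G 0 0 * Determinant.det
      (Matrix.mat k k (\<lambda>(i, j). G (Suc i) (Suc j) - G (Suc i) 0 / G 0 0 * G 0 (Suc j)))"
proof -
  define n where "n = Suc k"
  define P where "P = Matrix.mat n n
    (\<lambda>(i, j). if j = 0 then G i 0 / G 0 0 else if i = j then 1 else 0)"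
  define Q where "Q = Matrix.mat n n
    (\<lambda>(i, j). if i = 0 then G 0 j else G i j - G i 0 / G 0 0 * G 0 j)"
  have carr: "P \<in> carrier_mat n n" "Q \<in> carrier_mat n n" by (auto simp: P_def Q_def)
  have "Matrix.mat n n (\<lambda>(i, j). G i j) = P * Q"
  proof (rule eq_matI)
    fix i j assume "i < dim_row (P * Q)" "j < dim_col (P * Q)"
    then have ij: "i < n" "j < n" by (auto simp: P_def Q_def)
    have "(P * Q) $$ (i, j) = (\<Sum>l = 0..<n. P $$ (i, l) * Q $$ (l, j))"
      using ij carr by (simp add: scalar_prod_def)
    also have "\<dots> = P $$ (i, 0) * Q $$ (0, j) + (\<Sum>l = 1..<n. P $$ (i, l) * Q $$ (l, j))"
      by (simp add: n_def sum.atLeast_Suc_lessThan)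
    also have "(\<Sum>l = 1..<n. P $$ (i, l) * Q $$ (l, j)) =
        (\<Sum>l = 1..<n. if l = i then Q $$ (i, j) else 0)"
      using ij by (intro sum.cong) (auto simp: P_def)
    also have "P $$ (i, 0) * Q $$ (0, j) + \<dots> = G i j"
      using ij assms by (cases "i = 0") (auto simp: P_def Q_def)
    finally show "Matrix.mat n n (\<lambda>(i, j). G i j) $$ (i, j) = (P * Q) $$ (i, j)"
      using ij by simp
  qed (auto simp: P_def Q_def)
  then have "Determinant.det (Matrix.mat n n (\<lambda>(i, j). G i j)) = Determinant.det P * Determinant.det Q"
    using det_mult carr by metis
  moreover have "Determinant.det P = 1"
  proof -
    have "Determinant.det P = prod_list (diag_mat P)"
      by (rule det_lower_triangular[OF _ carr(1)]) (auto simp: P_def)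
    also have "\<dots> = (\<Prod>i = 0..<n. P $$ (i, i))"
      by (simp add: prod_list_diag_prod P_def)
    also have "\<dots> = 1" using assms by (intro prod.neutral) (auto simp: P_def)
    finally show ?thesis .
  qed
  moreover have "Determinant.det Q = G 0 0 * Determinant.det
      (Matrix.mat k k (\<lambda>(i, j). G (Suc i) (Suc j) - G (Suc i) 0 / G 0 0 * G 0 (Suc j)))"
  proof -
    have "Determinant.det Q = (\<Sum>i<n. Q $$ (i, 0) * cofactor Q i 0)"
      using carr by (intro laplace_expansion_column) (auto simp: n_def)
    also have "\<dots> = (\<Sum>i<n. if i = 0 then Q $$ (0, 0) * cofactor Q 0 0 else 0)"
      using assms by (intro sum.cong) (auto simp: Q_def n_def)
    also have "\<dots> = G 0 0 * Determinant.det (mat_delete Q 0 0)"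
      by (simp add: n_def cofactor_def Q_def)
    also have "mat_delete Q 0 0 =
        Matrix.mat k k (\<lambda>(i, j). G (Suc i) (Suc j) - G (Suc i) 0 / G 0 0 * G 0 (Suc j))"
      by (rule eq_matI) (auto simp: mat_delete_def Q_def n_def)
    finally show ?thesis .
  qed
  ultimately show ?thesis by (simp add: n_def)
qed

text \<open>
  This is Polya's argument that positive Wronskians bound the number of zeros. For plain Wronskian
  matrices, \<open>G i (Suc j)\<close> is the derivative of \<open>G i j\<close>. The additional multiples of the columns up
  to \<open>j\<close>, with coefficients that are the same in every row, make the hypothesis stable under
  elimination: the zeros of \<open>\<Sum>i. c i * G i 0\<close> are those of \<open>\<Sum>i. c i * (G i 0 / G 0 0)\<close>; the
  derivative of \<open>G (Suc i) 0 / G 0 0\<close> is \<open>F i 0 / G 0 0\<close>, where \<open>F\<close> is the Schur complement of the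
  entry \<open>G 0 0\<close>; and \<open>F\<close> again satisfies the hypothesis, with the new coefficients \<open>C\<close>. In this form
  only first derivatives of quotients occur.
\<close>
lemma card_zeros_combination_less:
  fixes G B :: "nat \<Rightarrow> nat \<Rightarrow> real \<Rightarrow> real"
  assumes "\<And>i j t. i < n \<Longrightarrow> Suc j < n \<Longrightarrow> t \<in> {a<..<b} \<Longrightarrow>
      (G i j has_real_derivative G i (Suc j) t + (\<Sum>l\<le>j. G i l t * B l j t)) (at t)"
    and "\<And>k t. k \<in> {1..n} \<Longrightarrow> t \<in> {a<..<b} \<Longrightarrow>
      Determinant.det (Matrix.mat k k (\<lambda>(i, j). G i j t)) > 0"
    and "\<exists>i<n. c i \<noteq> 0"
    and "finite Z" "Z \<subseteq> {a<..<b}" "\<And>t. t \<in> Z \<Longrightarrow> (\<Sum>i<n. c i * G i 0 t) = 0"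
  shows "card Z < n"
  using assms
proof (induction n arbitrary: G B c Z)
  case 0
  then show ?case by simp
next
  case (Suc n)
  note der = Suc.prems(1) and minors = Suc.prems(2) and Z = Suc.prems(4-6)
  have pos: "G 0 0 t > 0" if "t \<in> {a<..<b}" for t
  proof -
    have "Matrix.mat 1 1 (\<lambda>(i, j). G i j t) \<in> carrier_mat 1 1" by simp
    then have "Determinant.det (Matrix.mat 1 1 (\<lambda>(i, j). G i j t)) = G 0 0 t"
      by (subst det_single) auto
    then show ?thesis using minors[of 1 t] that by simp
  qed
  show ?case
  proof (cases "\<exists>i<n. c (Suc i) \<noteq> 0")
    case False
    then have c0: "c 0 \<noteq> 0" using Suc.prems(3) by (metis less_Suc_eq_0_disj)
    have "(\<Sum>i<Suc n. c i * G i 0 t) = c 0 * G 0 0 t" for t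
      using False unfolding sum.lessThan_Suc_shift by simp
    then have "Z = {}" using Z pos c0 by (force simp del: sum.lessThan_Suc)
    then show ?thesis by simp
  next
    case True
    then have n: "n > 0" by auto
    define F where "F = (\<lambda>i j t. G (Suc i) (Suc j) t - G (Suc i) 0 t / G 0 0 t * G 0 (Suc j) t)"
    define C where
      "C = (\<lambda>l j t. B (Suc l) (Suc j) t - (if l = 0 then G 0 (Suc j) t / G 0 0 t else 0))"
    have quot: "((\<lambda>t. G i 0 t / G 0 0 t) has_real_derivative
        (G i 1 t - G i 0 t / G 0 0 t * G 0 1 t) / G 0 0 t) (at t)"
      if "i < Suc n" "t \<in> {a<..<b}" for i t
    proof -
      note d = der[of i 0 t] der[of 0 0 t]
      show ?thesis
        by (rule DERIV_cong[OF DERIV_divide[OF d]])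
          (use n that pos[of t] in \<open>auto simp: field_simps\<close>)
    qed
    show ?thesis
    proof (cases "Z = {}")
      case True
      then show ?thesis by simp
    next
      case False
      define f where "f = (\<lambda>t. \<Sum>i<Suc n. c i * (G i 0 t / G 0 0 t))"
      define f' where "f' = (\<lambda>t. \<Sum>i<Suc n. c i *
        ((G i 1 t - G i 0 t / G 0 0 t * G 0 1 t) / G 0 0 t))"
      have df: "(f has_real_derivative f' t) (at t)" if "t \<in> {a<..<b}" for t
        unfolding f_def f'_def using quot that
        by (intro DERIV_sum DERIV_cmult) auto
      have f0: "f t = 0" if "t \<in> Z" for t
      proof -
        have "f t = (\<Sum>i<Suc n. c i * G i 0 t) / G 0 0 t"
          by (simp only: f_def sum_divide_distrib times_divide_eq_right)
        then show ?thesis using Z(3)[OF that] by simp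
      qed
      obtain W where W: "finite W" "W \<subseteq> {a<..<b}" "Suc (card W) = card Z" "\<And>t. t \<in> W \<Longrightarrow> f' t = 0"
      proof (rule Rolle_zeros_between[OF Z(1) False Z(2), of f f'])
        show "continuous_on {a<..<b} f"
          by (intro continuous_at_imp_continuous_on ballI DERIV_isCont[OF df])
      qed (use df f0 that in \<open>auto simp: is_interval_oo\<close>)
      have "card W < n"
      proof (rule Suc.IH[of F C "\<lambda>i. c (Suc i)" W])
        fix i j t assume ij: "i < n" "Suc j < n" and t: "t \<in> {a<..<b}"
        define q where "q = G (Suc i) 0 t / G 0 0 t"
        have p: "G 0 0 t \<noteq> 0" using pos[OF t] by simp
        let ?S = "\<Sum>l\<le>j. F i l t * B (Suc l) (Suc j) t"
        \<comment> \<open>The terms \<open>l = 0\<close> cancel, because elimination makes the first column vanish.\<close>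
        have split: "(\<Sum>l\<le>Suc j. G (Suc i) l t * B l (Suc j) t) -
            q * (\<Sum>l\<le>Suc j. G 0 l t * B l (Suc j) t) = ?S"
        proof -
          have "(\<Sum>l\<le>Suc j. G (Suc i) l t * B l (Suc j) t) -
            q * (\<Sum>l\<le>Suc j. G 0 l t * B l (Suc j) t) =
            (\<Sum>l\<le>Suc j. (G (Suc i) l t - q * G 0 l t) * B l (Suc j) t)"
            by (simp only: sum_distrib_left sum_subtractf[symmetric] left_diff_distrib mult.assoc)
          also have "\<dots> = ?S"
            unfolding sum.atMost_Suc_shift using p by (simp add: q_def F_def)
          finally show ?thesis .
        qed
        have C: "(\<Sum>l\<le>j. F i l t * C l j t) = ?S - F i 0 t / G 0 0 t * G 0 (Suc j) t"
        proof -
          have "(\<Sum>l\<le>j. F i l t * C l j t) =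
            (\<Sum>l\<le>j. F i l t * B (Suc l) (Suc j) t - (if l = 0 then F i 0 t * (G 0 (Suc j) t / G 0 0 t) else 0))"
            by (intro sum.cong) (auto simp: C_def algebra_simps)
          also have "\<dots> = ?S - F i 0 t * (G 0 (Suc j) t / G 0 0 t)"
            by (simp add: sum_subtractf)
          finally show ?thesis by simp
        qed
        note d1 = der[of "Suc i" "Suc j" t] and d0 = der[of 0 "Suc j" t] and dq = quot[of "Suc i" t]
        have "(F i j has_real_derivative
            (G (Suc i) (Suc (Suc j)) t + (\<Sum>l\<le>Suc j. G (Suc i) l t * B l (Suc j) t)) -
            ((G (Suc i) 1 t - G (Suc i) 0 t / G 0 0 t * G 0 1 t) / G 0 0 t * G 0 (Suc j) t +
             (G 0 (Suc (Suc j)) t + (\<Sum>l\<le>Suc j. G 0 l t * B l (Suc j) t)) * q)) (at t)"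
          unfolding F_def q_def using ij t
          by (intro DERIV_diff DERIV_mult d1 d0 dq) auto
        then show "(F i j has_real_derivative F i (Suc j) t + (\<Sum>l\<le>j. F i l t * C l j t)) (at t)"
        proof (rule DERIV_cong)
          have F0: "(G (Suc i) 1 t - G (Suc i) 0 t / G 0 0 t * G 0 1 t) = F i 0 t"
            by (simp add: F_def)
          have F1: "F i (Suc j) t = G (Suc i) (Suc (Suc j)) t - q * G 0 (Suc (Suc j)) t"
            by (simp add: F_def q_def)
          show "(G (Suc i) (Suc (Suc j)) t + (\<Sum>l\<le>Suc j. G (Suc i) l t * B l (Suc j) t)) -
            ((G (Suc i) 1 t - G (Suc i) 0 t / G 0 0 t * G 0 1 t) / G 0 0 t * G 0 (Suc j) t +
             (G 0 (Suc (Suc j)) t + (\<Sum>l\<le>Suc j. G 0 l t * B l (Suc j) t)) * q) =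
             F i (Suc j) t + (\<Sum>l\<le>j. F i l t * C l j t)"
            unfolding F0 F1 C split[symmetric] by (simp only: algebra_simps)
        qed
      next
        fix k t assume k: "k \<in> {1..n}" and t: "t \<in> {a<..<b}"
        have "0 < Determinant.det (Matrix.mat (Suc k) (Suc k) (\<lambda>(i, j). G i j t))"
          using k t by (intro minors) auto
        also have "\<dots> = G 0 0 t * Determinant.det (Matrix.mat k k (\<lambda>(i, j). F i j t))"
          using pos[OF t] unfolding F_def
          by (intro det_eq_pivot_times_det_Schur_complement[of "\<lambda>i j. G i j t"]) simp
        finally show "0 < Determinant.det (Matrix.mat k k (\<lambda>(i, j). F i j t))"
          using pos[OF t] by (simp add: zero_less_mult_iff)
      next
        fix t assume t: "t \<in> W"
        then have p: "G 0 0 t > 0" using W pos by auto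
        have "f' t = (\<Sum>i<n. c (Suc i) * F i 0 t) / G 0 0 t"
          unfolding f'_def sum.lessThan_Suc_shift sum_divide_distrib
          using p by (simp add: F_def)
        then show "(\<Sum>i<n. c (Suc i) * F i 0 t) = 0" using W(4)[OF t] p by simp
      qed (use True W in auto)
      then show ?thesis using W(3) by simp
    qed
  qed
qed


section \<open>Hyperplanes and the curve\<close>

lemma bij_betw_coord: "bij_betw (coord :: nat \<Rightarrow> 'n::{finite,linorder}) {..<CARD('n)} UNIV"
proof -
  have "(coord :: nat \<Rightarrow> 'n) = (!) (sorted_list_of_set UNIV)"
    by (auto simp: coord_def)
  moreover have "bij_betw ((!) (sorted_list_of_set (UNIV :: 'n set))) {..<CARD('n)} UNIV"
    by (rule bij_betw_nth) simp_all
  ultimately show ?thesis by metis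
qed

lemma inner_eq_sum_coord:
  fixes c x :: "real ^ 'n::{finite,linorder}"
  shows "c \<bullet> x = (\<Sum>i<CARD('n). c $ coord i * x $ coord i)"
  unfolding inner_vec_def
  using sum.reindex_bij_betw[OF bij_betw_coord, of "\<lambda>i. c $ i * x $ i"] by simp

lemma Ck_on_has_vector_derivative:
  assumes "Ck_on k S f" "j < k" "t \<in> S"
  shows "(nth_vector_derivative j f has_vector_derivative nth_vector_derivative (Suc j) f t) (at t)"
proof -
  have "nth_vector_derivative j f differentiable (at t)"
    using assms by (auto simp: Ck_on_def)
  then show ?thesis
    by (simp add: vector_derivative_works nth_vector_derivative_def)
qed

lemma totally_positive_torsion_inner_has_derivative:
  fixes \<gamma> :: "real \<Rightarrow> real ^ 'n::{finite,linorder}"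
  assumes "totally_positive_torsion a b \<gamma>" "t \<in> {a<..<b}"
  shows "((\<lambda>t. c \<bullet> \<gamma> t) has_real_derivative c \<bullet> nth_vector_derivative (Suc 0) \<gamma> t) (at t)"
proof -
  have "(\<gamma> has_vector_derivative nth_vector_derivative (Suc 0) \<gamma> t) (at t)"
    using Ck_on_has_vector_derivative[of "CARD('n)" "{a<..<b}" \<gamma> 0 t] assms
    by (simp add: totally_positive_torsion_def nth_vector_derivative_def)
  then show ?thesis
    using bounded_linear.has_vector_derivative[OF bounded_linear_inner_right]
    by (simp add: has_real_derivative_iff_has_vector_derivative)
qed

lemma card_zeros_inner_derivative_less:
  fixes \<gamma> :: "real \<Rightarrow> real ^ 'n::{finite,linorder}"
  assumes tp: "totally_positive_torsion a b \<gamma>" and "c \<noteq> 0"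
    and "finite Z" "Z \<subseteq> {a<..<b}"
    and "\<And>t. t \<in> Z \<Longrightarrow> c \<bullet> nth_vector_derivative (Suc 0) \<gamma> t = 0"
  shows "card Z < CARD('n)"
proof (rule card_zeros_combination_less)
  let ?G = "\<lambda>i j t. nth_vector_derivative (Suc j) \<gamma> t $ coord i"
  show "(?G i j has_real_derivative ?G i (Suc j) t + (\<Sum>l\<le>j. ?G i l t * 0)) (at t)"
    if "i < CARD('n)" "Suc j < CARD('n)" "t \<in> {a<..<b}" for i j t
  proof -
    have "(nth_vector_derivative (Suc j) \<gamma> has_vector_derivative
        nth_vector_derivative (Suc (Suc j)) \<gamma> t) (at t)"
      using tp that by (intro Ck_on_has_vector_derivative) (auto simp: totally_positive_torsion_def)
    then show ?thesis
      using bounded_linear.has_vector_derivative[OF bounded_linear_vec_nth]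
      by (simp add: has_real_derivative_iff_has_vector_derivative)
  qed
  show "0 < Determinant.det (Matrix.mat k k (\<lambda>(i, j). ?G i j t))"
    if "k \<in> {1..CARD('n)}" "t \<in> {a<..<b}" for k t
  proof -
    have "Matrix.mat k k (\<lambda>(i, j). ?G i j t) =
        Matrix.mat k k (\<lambda>(i, j). torsion_matrix \<gamma> t $$ (i, j))"
      using that by (intro eq_matI) (auto simp: torsion_matrix_def)
    then show ?thesis
      using tp that by (simp add: totally_positive_torsion_def leading_principal_minor_def)
  qed
  show "\<exists>i<CARD('n). c $ coord i \<noteq> 0"
  proof (rule ccontr)
    assume "\<not> ?thesis"
    then have "c \<bullet> c = 0" by (simp add: inner_eq_sum_coord)
    then show False using \<open>c \<noteq> 0\<close> by simp
  qed
  show "(\<Sum>i<CARD('n). c $ coord i * ?G i 0 t) = 0" if "t \<in> Z" for t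
    using assms(5)[OF that] by (simp add: inner_eq_sum_coord)
qed (use assms in auto)

lemma card_hyperplane_section_le:
  fixes \<gamma> :: "real \<Rightarrow> real ^ 'n::{finite,linorder}"
  assumes tp: "totally_positive_torsion a b \<gamma>" and c: "c \<noteq> 0"
    and Z: "finite Z" "Z \<subseteq> {a..b}" "\<And>t. t \<in> Z \<Longrightarrow> c \<bullet> \<gamma> t = d"
  shows "card Z \<le> CARD('n)"
proof (cases "Z = {}")
  case False
  let ?f = "\<lambda>t. c \<bullet> \<gamma> t - d" and ?f' = "\<lambda>t. c \<bullet> nth_vector_derivative (Suc 0) \<gamma> t"
  have cont: "continuous_on {a..b} ?f"
    using tp by (auto simp: totally_positive_torsion_def intro!: continuous_intros)
  have der: "(?f has_real_derivative ?f' t) (at t)" if "t \<in> interior {a..b}" for t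
    using totally_positive_torsion_inner_has_derivative[OF tp, of t c] that
    by (auto intro!: derivative_eq_intros)
  obtain W where "finite W" "W \<subseteq> {a<..<b}" "Suc (card W) = card Z" "\<And>t. t \<in> W \<Longrightarrow> ?f' t = 0"
    using Rolle_zeros_between[OF Z(1) False Z(2) is_interval_cc cont der] Z(3)
    by (metis eq_iff_diff_eq_0 interior_atLeastAtMost_real)
  then show ?thesis
    using card_zeros_inner_derivative_less[OF tp c, of W] by simp
qed simp

text \<open>
  A contact in the interior of the arc is a minimum of \<open>c \<bullet> \<gamma>\<close>, so the derivative vanishes there as
  well as between contacts. At the two ends \<open>a\<close> and \<open>s\<close> nothing is known, which costs the \<open>2\<close>.
\<close>
lemma card_supporting_contacts_le:
  fixes \<gamma> :: "real \<Rightarrow> real ^ 'n::{finite,linorder}"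
  assumes tp: "totally_positive_torsion a b \<gamma>" and "s \<le> b" and c: "c \<noteq> 0"
    and support: "\<And>t. t \<in> {a..s} \<Longrightarrow> d \<le> c \<bullet> \<gamma> t"
    and Z: "finite Z" "Z \<subseteq> {a..s}" "\<And>t. t \<in> Z \<Longrightarrow> c \<bullet> \<gamma> t = d"
  shows "2 * card Z \<le> CARD('n) + 2"
proof (cases "Z = {}")
  case False
  let ?f = "\<lambda>t. c \<bullet> \<gamma> t - d" and ?f' = "\<lambda>t. c \<bullet> nth_vector_derivative (Suc 0) \<gamma> t"
  have cont: "continuous_on {a..s} ?f"
    using tp \<open>s \<le> b\<close>
    by (auto simp: totally_positive_torsion_def intro!: continuous_intros elim: continuous_on_subset)
  have der: "(?f has_real_derivative ?f' t) (at t)" if "t \<in> interior {a..s}" for t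
    using totally_positive_torsion_inner_has_derivative[OF tp, of t c] that \<open>s \<le> b\<close>
    by (auto intro!: derivative_eq_intros)
  obtain W where W: "finite W" "W \<subseteq> {a<..<s}" "W \<inter> Z = {}" "Suc (card W) = card Z"
      "\<And>t. t \<in> W \<Longrightarrow> ?f' t = 0"
    using Rolle_zeros_between[OF Z(1) False Z(2) is_interval_cc cont der] Z(3)
    by (metis eq_iff_diff_eq_0 interior_atLeastAtMost_real)
  have stationary: "?f' t = 0" if t: "t \<in> Z - {a, s}" for t
  proof -
    have ts: "t \<in> {a<..<s}" using t Z(2) by fastforce
    show ?thesis
    proof (rule DERIV_local_min[OF der])
      show "0 < min (t - a) (s - t)" using ts by simp
      show "\<forall>y. \<bar>t - y\<bar> < min (t - a) (s - t) \<longrightarrow> c \<bullet> \<gamma> t - d \<le> c \<bullet> \<gamma> y - d"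
      proof (intro allI impI)
        fix y assume "\<bar>t - y\<bar> < min (t - a) (s - t)"
        then have "y \<in> {a..s}" by auto
        then show "c \<bullet> \<gamma> t - d \<le> c \<bullet> \<gamma> y - d"
          using support[of y] Z(3)[of t] t by simp
      qed
    qed (use ts in simp)
  qed
  have "Z - {a, s} \<subseteq> {a<..<b}" using Z(2) \<open>s \<le> b\<close> by fastforce
  moreover have "W \<subseteq> {a<..<b}" using W(2) \<open>s \<le> b\<close> by fastforce
  ultimately have "card (W \<union> (Z - {a, s})) < CARD('n)"
    using W Z(1) stationary
    by (intro card_zeros_inner_derivative_less[OF tp c]) auto
  moreover have "card (W \<union> (Z - {a, s})) = card W + card (Z - {a, s})"
    using W Z(1) by (intro card_Un_disjoint) auto
  moreover have "card Z \<le> card (Z - {a, s}) + 2"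
  proof -
    have "card Z \<le> card ((Z - {a, s}) \<union> {a, s})" using Z(1) by (intro card_mono) auto
    also have "\<dots> \<le> card (Z - {a, s}) + card {a, s}" by (rule card_Un_le)
    also have "card {a, s} \<le> 2" by (simp add: card_insert_if)
    finally show ?thesis by simp
  qed
  ultimately show ?thesis using W(4) by linarith
qed simp

section \<open>Few points suffice\<close>

lemma finite_subset_max_image:
  fixes g :: "'a::linorder \<Rightarrow> 'b"
  assumes "finite S" "S \<noteq> {}" "S \<subseteq> g ` {a..<b}"
  obtains r where "r \<in> {a..<b}" "S \<subseteq> g ` {a..r}"
proof -
  obtain T where T: "T \<subseteq> {a..<b}" "finite T" "S = g ` T"
    using finite_subset_image[OF assms(1,3)] by blast
  then have "T \<noteq> {}" using assms(2) by auto
  have "Max T \<in> {a..<b}" using T \<open>T \<noteq> {}\<close> Max_in by blast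
  moreover have "S \<subseteq> g ` {a..Max T}"
  proof -
    have "T \<subseteq> {a..Max T}" using T by fastforce
    then show ?thesis using T(3) by blast
  qed
  ultimately show ?thesis using that by blast
qed

text \<open>
  The arc \<open>\<gamma> ` {a..b}\<close> is shortened from the right for as long as its convex hull contains \<open>x\<close>. This
  puts \<open>x\<close> on a supporting hyperplane of the shortened arc, and \<open>card_supporting_contacts_le\<close> gives
  the same bound for it as for the whole curve.
\<close>
lemma convex_combination_of_at_most_card_curve_points:
  fixes \<gamma> :: "real \<Rightarrow> real ^ 'n::{finite,linorder}"
  assumes ab: "a < b" and tp: "totally_positive_torsion a b \<gamma>"
    and x: "x \<in> convex hull (\<gamma> ` {a..b})"
  shows "convex_combination_of_at_most ((CARD('n) + 2) div 2) (\<gamma> ` {a..b}) x"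
proof -
  have cont: "continuous_on {a..b} \<gamma>" using tp by (simp add: totally_positive_torsion_def)
  define H where "H = (\<lambda>r. convex hull (\<gamma> ` {a..r}))"
  have H_mono: "H r \<subseteq> H r'" if "r \<le> r'" for r r'
    unfolding H_def using that by (intro hull_mono image_mono) auto
  define R where "R = {r \<in> {a..b}. x \<in> H r}"
  have bR: "b \<in> R" using x ab by (simp add: R_def H_def)
  have bdd: "bdd_below R" by (rule bdd_belowI[of _ a]) (simp add: R_def)
  define s where "s = Inf R"
  have "a \<le> s" unfolding s_def using bR by (intro cInf_greatest) (auto simp: R_def)
  have "s \<le> b" unfolding s_def using bR bdd by (rule cInf_lower)
  have not_in_H: "x \<notin> H r" if "a \<le> r" "r < s" for r
  proof
    assume "x \<in> H r"
    then have "r \<in> R" using that \<open>s \<le> b\<close> by (simp add: R_def)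
    then show False using cInf_lower[OF _ bdd] that(2) by (fastforce simp: s_def)
  qed
  \<comment> \<open>The infimum is attained: a hyperplane strictly separating \<open>x\<close> from \<open>H s\<close> would by continuity
    also separate it from \<open>H r\<close> for \<open>r\<close> slightly larger than \<open>s\<close>.\<close>
  have xs: "x \<in> H s"
  proof (rule ccontr)
    assume "x \<notin> H s"
    have "closed (H s)"
      unfolding H_def using \<open>s \<le> b\<close>
      by (intro compact_imp_closed compact_convex_hull compact_continuous_image
          continuous_on_subset[OF cont]) auto
    then obtain c d where cd: "c \<bullet> x < d" "\<And>y. y \<in> H s \<Longrightarrow> d < c \<bullet> y"
      using separating_hyperplane_closed_point[of "H s" x] \<open>x \<notin> H s\<close>
      by (auto simp: H_def)
    have gs: "\<gamma> t \<in> H s" if "t \<in> {a..s}" for t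
      using that by (auto simp: H_def intro: hull_inc)
    have "continuous_on {a..b} (\<lambda>t. c \<bullet> \<gamma> t)" by (intro continuous_intros cont)
    then have "((\<lambda>t. c \<bullet> \<gamma> t) \<longlongrightarrow> c \<bullet> \<gamma> s) (at s within {a..b})"
      using \<open>a \<le> s\<close> \<open>s \<le> b\<close> by (auto simp: continuous_on_def)
    moreover have "d < c \<bullet> \<gamma> s" using cd gs \<open>a \<le> s\<close> by auto
    ultimately have "eventually (\<lambda>t. d < c \<bullet> \<gamma> t) (at s within {a..b})"
      by (rule order_tendstoD)
    then obtain e where e: "e > 0" "\<And>t. t \<in> {a..b} \<Longrightarrow> t \<noteq> s \<Longrightarrow> dist t s < e \<Longrightarrow> d < c \<bullet> \<gamma> t"
      unfolding eventually_at by blast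
    obtain r where r: "r \<in> R" "r < s + e"
      using cInf_lessD[of R "s + e"] bR e(1) by (auto simp: s_def)
    have "d < c \<bullet> \<gamma> t" if t: "t \<in> {a..r}" for t
    proof (cases "t \<le> s")
      case True
      then show ?thesis using cd gs t by auto
    next
      case False
      then show ?thesis using e(2)[of t] t r by (auto simp: R_def dist_real_def)
    qed
    then have "H r \<subseteq> {y. d < c \<bullet> y}"
      unfolding H_def by (intro hull_minimal convex_halfspace_gt) auto
    moreover have "x \<in> H r" using r by (simp add: R_def)
    ultimately show False using cd(1) by auto
  qed
  show ?thesis
  proof (cases "s = a")
    case True
    then have "x = \<gamma> a" using xs by (simp add: H_def)
    then show ?thesis
      unfolding convex_combination_of_at_most_def using ab
      by (intro exI[of _ "{\<gamma> a}"] exI[of _ "\<lambda>_. 1"]) auto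
  next
    case False
    then have "a < s" using \<open>a \<le> s\<close> by simp
    define K where "K = convex hull (\<gamma> ` {a..<s})"
    have "x \<notin> K"
    proof
      assume "x \<in> K"
      obtain S where S: "finite S" "S \<subseteq> \<gamma> ` {a..<s}" "x \<in> convex hull S"
      proof -
        obtain S u where S: "finite S" "S \<subseteq> \<gamma> ` {a..<s}"
            "\<forall>p\<in>S. 0 \<le> u p" "sum u S = 1" "(\<Sum>p\<in>S. u p *\<^sub>R p) = x"
          using \<open>x \<in> K\<close> unfolding K_def convex_hull_explicit by blast
        then have "x \<in> convex hull S"
          unfolding convex_hull_finite[OF S(1)] by blast
        then show ?thesis by (rule that[OF S(1,2)])
      qed
      then have "S \<noteq> {}" by auto
      then obtain r where "r \<in> {a..<s}" "S \<subseteq> \<gamma> ` {a..r}"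
        using finite_subset_max_image[OF S(1)] S(2) by blast
      then have "x \<in> H r" using S(3) hull_mono[of S "\<gamma> ` {a..r}"] by (auto simp: H_def)
      then show False using not_in_H \<open>r \<in> {a..<s}\<close> by auto
    qed
    then obtain c d where c: "c \<noteq> 0" "c \<bullet> x \<le> d" "\<And>y. y \<in> K \<Longrightarrow> d \<le> c \<bullet> y"
      using separating_hyperplane_sets[of "{x}" K] \<open>a < s\<close> by (auto simp: K_def)
    have cont_f: "continuous_on {a..s} (\<lambda>t. c \<bullet> \<gamma> t)"
      using \<open>s \<le> b\<close> by (intro continuous_intros continuous_on_subset[OF cont]) auto
    have above: "c \<bullet> x \<le> c \<bullet> \<gamma> t" if "t \<in> {a..s}" for t
    proof (rule continuous_ge_on_closure[where S = "{a..<s}" and f = "\<lambda>t. c \<bullet> \<gamma> t"])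
      show "continuous_on (closure {a..<s}) (\<lambda>t. c \<bullet> \<gamma> t)"
        using cont_f \<open>a < s\<close> by simp
      show "t \<in> closure {a..<s}" using that \<open>a < s\<close> by simp
      show "c \<bullet> x \<le> c \<bullet> \<gamma> t" if "t \<in> {a..<s}" for t
      proof -
        have "\<gamma> t \<in> K" unfolding K_def using that by (intro hull_inc) auto
        then show ?thesis using c(2,3) by force
      qed
    qed
    obtain S u where S: "finite S" "S \<subseteq> \<gamma> ` {a..s}" "\<And>p. p \<in> S \<Longrightarrow> 0 \<le> u p" "sum u S = 1"
        "(\<Sum>p\<in>S. u p *\<^sub>R p) = x"
      using xs unfolding H_def convex_hull_explicit by blast
    \<comment> \<open>Points of weight zero need not be contacts and are discarded.\<close>
    define S' where "S' = {p \<in> S. u p \<noteq> 0}"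
    have S': "finite S'" "S' \<subseteq> S" using S(1) by (auto simp: S'_def)
    have "sum u S' = sum u S" "(\<Sum>p\<in>S'. u p *\<^sub>R p) = (\<Sum>p\<in>S. u p *\<^sub>R p)"
      by (rule sum.mono_neutral_left[OF S(1)]; force simp: S'_def)+
    then have sum_S': "sum u S' = 1" "(\<Sum>p\<in>S'. u p *\<^sub>R p) = x"
      using S by simp_all
    have on: "c \<bullet> p = c \<bullet> x" if "p \<in> S'" for p
    proof -
      have "(\<Sum>p\<in>S. u p * (c \<bullet> p - c \<bullet> x)) = c \<bullet> (\<Sum>p\<in>S. u p *\<^sub>R p) - sum u S * (c \<bullet> x)"
        by (simp add: inner_sum_right right_diff_distrib sum_subtractf sum_distrib_right)
      also have "\<dots> = 0" using S by simp
      finally have sum0: "(\<Sum>p\<in>S. u p * (c \<bullet> p - c \<bullet> x)) = 0" .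
      have "0 \<le> u p * (c \<bullet> p - c \<bullet> x)" if "p \<in> S" for p
        using above S(2,3) that by (intro mult_nonneg_nonneg) auto
      then have "\<forall>p\<in>S. u p * (c \<bullet> p - c \<bullet> x) = 0"
        using sum_nonneg_eq_0_iff[OF S(1), of "\<lambda>p. u p * (c \<bullet> p - c \<bullet> x)"] sum0 by simp
      then show ?thesis using that by (auto simp: S'_def)
    qed
    obtain T where T: "T \<subseteq> {a..s}" "finite T" "S' = \<gamma> ` T"
      using finite_subset_image[OF S'(1)] S'(2) S(2) by (meson subset_trans)
    have "2 * card T \<le> CARD('n) + 2"
      using T on by (intro card_supporting_contacts_le[OF tp \<open>s \<le> b\<close> c(1) above]) auto
    then have "card S' \<le> (CARD('n) + 2) div 2"
      using card_image_le[OF T(2), of \<gamma>] T(3) by simp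
    then show ?thesis
      unfolding convex_combination_of_at_most_def
      using S S' sum_S' \<open>s \<le> b\<close>
      by (intro exI[of _ S'] exI[of _ u]) auto
  qed
qed

section \<open>Few points are necessary\<close>

text \<open>
  Were the points dependent, or two of them equal, they would span an affine subspace of dimension
  less than \<open>n\<close>, and some hyperplane would contain all \<open>n + 1\<close> of them.
\<close>
lemma affine_independent_curve_points:
  fixes \<gamma> :: "real \<Rightarrow> real ^ 'n::{finite,linorder}"
  assumes tp: "totally_positive_torsion a b \<gamma>"
    and T: "T \<subseteq> {a..b}" "finite T" "card T = CARD('n) + 1"
  shows "\<not> affine_dependent (\<gamma> ` T)" "inj_on \<gamma> T"
proof -
  have "\<not> aff_dim (\<gamma> ` T) < int CARD('n)"
  proof
    assume "aff_dim (\<gamma> ` T) < int CARD('n)"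
    then obtain c d where "c \<noteq> 0" "\<gamma> ` T \<subseteq> {x. c \<bullet> x = d}"
      using aff_lowdim_subset_hyperplane[of "\<gamma> ` T"] by auto
    then have "card T \<le> CARD('n)"
      using T by (intro card_hyperplane_section_le[OF tp, of c T d]) auto
    then show False using T by simp
  qed
  then have dim: "aff_dim (\<gamma> ` T) \<ge> int CARD('n)" by simp
  moreover have "aff_dim (\<gamma> ` T) \<le> int (card (\<gamma> ` T)) - 1"
    using T by (intro aff_dim_le_card) simp
  moreover have le: "card (\<gamma> ` T) \<le> CARD('n) + 1"
    using card_image_le[OF T(2)] T(3) by metis
  ultimately have eq: "card (\<gamma> ` T) = CARD('n) + 1" "aff_dim (\<gamma> ` T) = int (card (\<gamma> ` T)) - 1"
    by auto
  then show "\<not> affine_dependent (\<gamma> ` T)" using T by (simp add: affine_independent_iff_card)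
  show "inj_on \<gamma> T" using eq T by (intro eq_card_imp_inj_on) auto
qed

text \<open>
  Equal positive weights at all of \<open>A\<close> force any second representation to use every point of
  \<open>\<gamma> ` A\<close>, as long as both together use no more than \<open>n + 1\<close> points.
\<close>
lemma barycentre_needs_card_points:
  fixes \<gamma> :: "real \<Rightarrow> real ^ 'n::{finite,linorder}"
  assumes ab: "a < b" and tp: "totally_positive_torsion a b \<gamma>"
    and A: "A \<subseteq> {a..b}" "finite A" "A \<noteq> {}" "2 * card A \<le> CARD('n) + 2"
    and comb: "convex_combination_of_at_most k (\<gamma> ` {a..b}) (\<Sum>t\<in>A. (1 / card A) *\<^sub>R \<gamma> t)"
  shows "card A \<le> k"
proof (rule ccontr)
  assume "\<not> card A \<le> k"
  obtain S u where S: "finite S" "S \<subseteq> \<gamma> ` {a..b}" "card S \<le> k" "sum u S = 1"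
      "(\<Sum>p\<in>S. u p *\<^sub>R p) = (\<Sum>t\<in>A. (1 / card A) *\<^sub>R \<gamma> t)"
    using comb unfolding convex_combination_of_at_most_def by auto
  obtain B where B: "B \<subseteq> {a..b}" "finite B" "S = \<gamma> ` B" "card B = card S"
    using S(1,2) by (metis subset_image_inj card_image finite_imageD)
  have "card (A \<union> B) \<le> CARD('n) + 1"
    using card_Un_le[of A B] \<open>\<not> card A \<le> k\<close> A(4) S(3) B(4) by linarith
  obtain T where T: "A \<union> B \<subseteq> T" "T \<subseteq> {a..b}" "finite T" "card T = CARD('n) + 1"
  proof -
    have "infinite ({a..b} - (A \<union> B))"
      using infinite_Icc[OF ab] A B by (simp add: Diff_infinite_finite)
    then obtain D where D: "finite D" "card D = CARD('n) + 1 - card (A \<union> B)" "D \<subseteq> {a..b} - (A \<union> B)"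
      using infinite_arbitrarily_large by blast
    have "card (A \<union> B \<union> D) = card (A \<union> B) + card D"
      using D A B by (intro card_Un_disjoint) auto
    then show ?thesis
      using that[of "A \<union> B \<union> D"] D A B \<open>card (A \<union> B) \<le> _\<close> by auto
  qed
  note indep = affine_independent_curve_points[OF tp T(2-4)]
  let ?A = "\<gamma> ` A"
  let ?U = "?A \<union> S"
  have inj: "inj_on \<gamma> A" using indep(2) T(1) by (auto intro: inj_on_subset)
  then have cA: "card ?A = card A" by (rule card_image)
  have fin: "finite ?U" using A S by simp
  have "\<not> affine_dependent ?U"
    by (rule affine_independent_subset[OF indep(1)]) (use T(1) B in auto)
  moreover have "affine_dependent ?U"
  proof -
    define w where "w = (\<lambda>p. (if p \<in> ?A then 1 / real (card A) else 0) - (if p \<in> S then u p else 0))"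
    have c0: "card A > 0" using A by (simp add: card_gt_0_iff)
    have "\<not> ?A \<subseteq> S"
      using card_mono[OF S(1), of ?A] cA \<open>\<not> card A \<le> k\<close> S(3) by auto
    then obtain p where p: "p \<in> ?A" "p \<notin> S" by auto
    then have "w p \<noteq> 0" using c0 by (auto simp: w_def)
    moreover have "sum w ?U = 0"
    proof -
      have "sum w ?U = (\<Sum>p\<in>?U. if p \<in> ?A then 1 / real (card A) else 0) -
          (\<Sum>p\<in>?U. if p \<in> S then u p else 0)"
        unfolding w_def by (rule sum_subtractf)
      also have "\<dots> = (\<Sum>p\<in>?A. 1 / real (card A)) - sum u S"
        using fin by (simp add: sum.inter_restrict[symmetric] Int_absorb1)
      also have "\<dots> = 0" using S(4) cA c0 by simp
      finally show ?thesis .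
    qed
    moreover have "(\<Sum>p\<in>?U. w p *\<^sub>R p) = 0"
    proof -
      have "(\<Sum>p\<in>?U. w p *\<^sub>R p) = (\<Sum>p\<in>?U. if p \<in> ?A then (1 / real (card A)) *\<^sub>R p else 0) -
          (\<Sum>p\<in>?U. if p \<in> S then u p *\<^sub>R p else 0)"
        unfolding w_def sum_subtractf[symmetric] by (intro sum.cong) (auto simp: scaleR_left_diff_distrib)
      also have "\<dots> = (\<Sum>p\<in>?A. (1 / real (card A)) *\<^sub>R p) - (\<Sum>p\<in>S. u p *\<^sub>R p)"
        using fin by (simp add: sum.inter_restrict[symmetric] Int_absorb1)
      also have "\<dots> = 0" using S(5) by (simp add: sum.reindex[OF inj])
      finally show ?thesis .
    qed
    ultimately show ?thesis
      unfolding affine_dependent_explicit_finite[OF fin] using p(1) by blast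
  qed
  ultimately show False by contradiction
qed

section \<open>The Caratheodory number\<close>

theorem corollary2p6:
  fixes \<gamma> :: "real \<Rightarrow> real ^ 'n::{finite,linorder}" and a b :: real
  assumes "a < b" and "totally_positive_torsion a b \<gamma>"
  shows "caratheodory_number (\<gamma> ` {a..b}) = (CARD('n) + 2) div 2"
  unfolding caratheodory_number_def
proof (rule Least_equality)
  show "\<forall>x\<in>convex hull (\<gamma> ` {a..b}).
      convex_combination_of_at_most ((CARD('n) + 2) div 2) (\<gamma> ` {a..b}) x"
    using convex_combination_of_at_most_card_curve_points[OF assms] by blast
next
  fix k
  assume k: "\<forall>x\<in>convex hull (\<gamma> ` {a..b}). convex_combination_of_at_most k (\<gamma> ` {a..b}) x"
  obtain A where A: "finite A" "card A = (CARD('n) + 2) div 2" "A \<subseteq> {a..b}"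
    using infinite_arbitrarily_large[OF infinite_Icc[OF \<open>a < b\<close>]] by blast
  have "A \<noteq> {}" using A(2) by auto
  have "(\<Sum>t\<in>A. (1 / card A) *\<^sub>R \<gamma> t) \<in> convex hull (\<gamma> ` {a..b})"
    using A \<open>A \<noteq> {}\<close> by (intro convex_sum) (auto intro: hull_inc)
  then have "card A \<le> k"
    using k A \<open>A \<noteq> {}\<close> by (intro barycentre_needs_card_points[OF assms]) auto
  then show "(CARD('n) + 2) div 2 \<le> k" using A(2) by simp
qed

end
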